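(* In the setting described in the context, assume that each minimization problem defining the iterates has a solution, that the tangential cone condition of type A or of type B holds with constants $\eta\ge 0$ and $C_{\rm tc}\ge 1$, and that the multiplicative variational source condition holds with $u^*\in\partial\mathcal R(u^\dagger)$, $\beta\ge0$ and the concave index function $\varphi$. Suppose that $\eta$, $\mathcal D_{\mathcal R}^{u^*}(u_0,u^\dagger)$ and $\mathcal T(g^\dagger;F(u_0))$ are sufficiently small. (1) Exact data: the iterates $u_n$ with exact data $g^{\rm obs}=g^\dagger$ satisfy $$\mathcal D_{\mathcal R}^{u^*}(u_n,u^\dagger)=\mathcal O(\varphi^2(\alpha_n)),\qquad \mathcal T(g^\dagger;F(u_n))=\mathcal O(\Theta(\alpha_n))\qquad\text{as } n\to\infty. \quad ( * )$$ (2) Noisy data: define $$\mathbf{err}_n:=\frac1{C_{\rm err}}\mathbf{err}(F(u_{n+1}))+2\eta C_{\rm tc}\,\mathbf{err}(F(u_n))+C_{\rm tc}C_{\rm err}\,\mathbf{err}(g^\dagger)$$ if the tangential cone condition of type A is assumed, or $$\mathbf{err}_n:=\mathbf{err}\big(F(u_n)+F'(u_n;u_{n+1}-u_n)\big)+C_{\rm err}\,\mathbf{err}\big(F(u_n)+F'(u_n;u^\dagger-u_n)\big)$$ if the tangential cone condition of type B is assumed, and choose the stopping index $$n_*:=\min\{n\in\mathbb N : \Theta(\alpha_n)\le\tau\,\mathbf{err}_n\}$$ with a sufficiently large parameter $\tau\ge1$. Then the estimates $( * )$ hold for $n\le n_*$, and $$\mathcal D_{\mathcal R}^{u^*}(u_{n_*},u^\dagger)=\mathcal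 O\big(\varphi^2(\Theta^{-1}(\mathbf{err}_{n_*}))\big),\qquad \mathcal T(g^\dagger;F(u_{n_*}))=\mathcal O(\mathbf{err}_{n_*}).$$
   Context: Here $\mathbb N$ includes $0$. An index function is a continuous, monotonically increasing function $\varphi:[0,\infty)\to[0,\infty)$ with $\varphi(0)=0$. Operator and penalty. $\mathcal X,\mathcal Y$ are Banach spaces, $\mathfrak B\subset\mathcal X$ is convex. $F:\mathfrak B\to\mathcal Y$ is injective and continuous; the first variations $F'(u;v-u):=\lim_{t\searrow0}\frac1t(F(u+t(v-u))-F(u))$ exist for all $u,v\in\mathfrak B$, and $h\mapsto F'(u;h)$ extends to a bounded linear operator $F'[u]\in L(\mathcal X,\mathcal Y)$ for all $u\in\mathfrak B$. $\mathcal R:\mathcal X\to(-\infty,\infty]$ is proper and convex. Data. $u^\dagger\in\mathfrak B$ is the exact solution, $g^\dagger:=F(u^\dagger)$. $\mathcal Y^{\rm obs}$ is a set containing all possible observations and $g^{\rm obs}\in\mathcal Y^{\rm obs}$ is the observed data. $\mathcal T:F(\mathfrak B)\times\mathcal Y\to[0,\infty]$ satisfies $\mathcal T(g^\dagger;g^\dagger)=0$. $\mathcal S:\mathcal Y^{\rm obs}\times\mathcal Y\to(-\infty,\infty]$ (normalized by subtracting an additive constant $\mathfrak s(g^\dagger)$, so that $\mathfrak s\equiv0$) is such that there are $C_{\rm err}\ge1$ and $\mathbf{err}:\mathcal Y\to[0,\infty]$ with $$\mathcal S(g^{\rm obs};g)\le C_{\rm err}\mathcal T(g^\dagger;g)+C_{\rm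 err}\mathbf{err}(g),\qquad \mathcal T(g^\dagger;g)\le C_{\rm err}\mathcal S(g^{\rm obs};g)+C_{\rm err}\mathbf{err}(g)\qquad\forall g\in\mathcal Y.$$ "Exact data" means $g^{\rm obs}=g^\dagger$, with $\mathbf{err}\equiv0$. Iteration. For an initial guess $u_0\in\mathfrak B$, for $n\in\mathbb N$ let $u_{n+1}$ be a minimizer over $u\in\mathfrak B$ of $$\mathcal S(g^{\rm obs};F(u_n)+F'(u_n;u-u_n))+\alpha_n\mathcal R(u);$$ a minimizer is assumed to exist (not necessarily unique). The parameters satisfy $\alpha_0\le1$, $\alpha_n\searrow0$, $1\le\alpha_n/\alpha_{n+1}\le C_{\rm dec}$ for all $n$, with a constant $C_{\rm dec}$. Tangential cone condition of type A (constants $\eta$, $C_{\rm tc}\ge1$): for all $g^{\rm obs}\in\mathcal Y^{\rm obs}$ and all $u,v\in\mathfrak B$, $$\tfrac1{C_{\rm tc}}\mathcal S(g^{\rm obs};F(v))-\eta\,\mathcal S(g^{\rm obs};F(u))\le\mathcal S(g^{\rm obs};F(u)+F'(u;v-u))\le C_{\rm tc}\mathcal S(g^{\rm obs};F(v))+\eta\,\mathcal S(g^{\rm obs};F(u)).$$ Type B: for all $u,v\in\mathfrak B$, $$\tfrac1{C_{\rm tc}}\mathcal T(g^\dagger;F(v))-\eta\,\mathcal T(g^\dagger;F(u))\le\mathcal T(g^\dagger;F(u)+F'(u;v-u))\le C_{\rm tc}\mathcal T(g^\dagger;F(v))+\eta\,\mathcal T(g^\dagger;F(u)).$$ Bregman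 distance: for $u^*\in\partial\mathcal R(u^\dagger)$, $\mathcal D_{\mathcal R}^{u^*}(u,u^\dagger):=\mathcal R(u)-\mathcal R(u^\dagger)-\langle u^*,u-u^\dagger\rangle$. Multiplicative variational source condition: there are $u^*\in\partial\mathcal R(u^\dagger)\subset\mathcal X'$, $\beta\ge0$ and a concave index function $\varphi$ (positive on $(0,\infty)$) such that $$\langle u^*,u^\dagger-u\rangle\le\beta\,\mathcal D_{\mathcal R}^{u^*}(u,u^\dagger)^{1/2}\,\varphi\!\left(\frac{\mathcal T(g^\dagger;F(u))}{\mathcal D_{\mathcal R}^{u^*}(u,u^\dagger)}\right)\qquad\forall u\in\mathfrak B$$ (right-hand side read as $0$ if $\mathcal D_{\mathcal R}^{u^*}(u,u^\dagger)=0$), and $t\mapsto\varphi(t)/\sqrt t$ is monotonically decreasing. Set $\Theta(t):=t\varphi^2(t)$; $\Theta$ and its inverse are index functions. "Sufficiently small/large" means bounded above/below by positive thresholds determined by the other fixed quantities of the problem; $\mathcal O$-constants are independent of $n$ and, for noisy data, of $g^{\rm obs}$. *)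

theory Defs
  imports "HOL-Analysis.Analysis"
begin

definition index_function :: "(real \<Rightarrow> real) \<Rightarrow> bool" where
  "index_function \<phi> \<longleftrightarrow>
     continuous_on {0..} \<phi> \<and> mono_on {0..} \<phi> \<and> (\<forall>t\<ge>0. 0 \<le> \<phi> t) \<and> \<phi> 0 = 0"

definition Theta :: "(real \<Rightarrow> real) \<Rightarrow> real \<Rightarrow> real" where
  "Theta \<phi> t = t * (\<phi> t)\<^sup>2"

definition Theta_inv :: "(real \<Rightarrow> real) \<Rightarrow> real \<Rightarrow> real" where
  "Theta_inv \<phi> = inv_into {0..} (Theta \<phi>)"

text \<open>Extension of a monotone function on the nonnegative reals to infinity by its limit,
  so that index functions can be applied to misfit and error values in \<open>[0,\<infinity>]\<close>.\<close>

definition ext_inf :: "(real \<Rightarrow> real) \<Rightarrow> ereal \<Rightarrow> ereal" where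
  "ext_inf f x = (if x = \<infinity> then (SUP t\<in>{0..}. ereal (f t)) else ereal (f (real_of_ereal x)))"

definition first_variation ::
    "('x::real_normed_vector \<Rightarrow> 'y::real_normed_vector) \<Rightarrow> 'x \<Rightarrow> 'x \<Rightarrow> 'y" where
  "first_variation F u h = Lim (at_right 0) (\<lambda>t. (1 / t) *\<^sub>R (F (u + t *\<^sub>R h) - F u))"

definition linearization ::
    "('x::real_normed_vector \<Rightarrow> 'y::real_normed_vector) \<Rightarrow> 'x \<Rightarrow> 'x \<Rightarrow> 'y" where
  "linearization F u v = F u + first_variation F u (v - u)"

definition proper_convex :: "('x::real_vector \<Rightarrow> ereal) \<Rightarrow> bool" where
  "proper_convex R \<longleftrightarrow>
     (\<forall>u. R u \<noteq> -\<infinity>) \<and> (\<exists>u. R u \<noteq> \<infinity>) \<and>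
     (\<forall>u v t. 0 < t \<and> t < 1 \<longrightarrow>
        R ((1 - t) *\<^sub>R u + t *\<^sub>R v) \<le> ereal (1 - t) * R u + ereal t * R v)"

definition subdifferential ::
    "('x::real_normed_vector \<Rightarrow> ereal) \<Rightarrow> 'x \<Rightarrow> ('x \<Rightarrow>\<^sub>L real) set" where
  "subdifferential R x = {xs. \<forall>u. R x + ereal (blinfun_apply xs (u - x)) \<le> R u}"

definition bregman ::
    "('x::real_normed_vector \<Rightarrow> ereal) \<Rightarrow> ('x \<Rightarrow>\<^sub>L real) \<Rightarrow> 'x \<Rightarrow> 'x \<Rightarrow> ereal" where
  "bregman R xs u x = R u - R x - ereal (blinfun_apply xs (u - x))"

text \<open>The observations live in a type of their own, since they need not be elements of the image
  space (e.g. point processes). Exact data as an observation is therefore expressed through an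
  arbitrary map from the image space to observations. \<open>T\<close> is only relevant for first arguments in \<open>F ` B\<close>,
  \<open>S\<close> only for first arguments in \<open>Yobs\<close>.\<close>

locale newton_setting =
  fixes B :: "'x::banach set"
    and F :: "'x \<Rightarrow> 'y::banach"
    and R :: "'x \<Rightarrow> ereal"
    and Yobs :: "'o set"
    and S :: "'o \<Rightarrow> 'y \<Rightarrow> ereal"
    and T :: "'y \<Rightarrow> 'y \<Rightarrow> ereal"
    and udag :: 'x
  assumes convex_B: "convex B"
    and inj_F: "inj_on F B"
    and cont_F: "continuous_on B F"
    and variation_exists:
      "\<And>u v. u \<in> B \<Longrightarrow> v \<in> B \<Longrightarrow>
         \<exists>l. ((\<lambda>t. (1 / t) *\<^sub>R (F (u + t *\<^sub>R (v - u)) - F u)) \<longlongrightarrow> l) (at_right 0)"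
    and variation_extends:
      "\<And>u. u \<in> B \<Longrightarrow>
         \<exists>L :: 'x \<Rightarrow>\<^sub>L 'y. \<forall>v\<in>B. first_variation F u (v - u) = blinfun_apply L (v - u)"
    and proper_convex_R: "proper_convex R"
    and udag_in_B: "udag \<in> B"
    and S_range: "\<And>gobs g. gobs \<in> Yobs \<Longrightarrow> S gobs g \<noteq> -\<infinity>"
    and T_range: "\<And>g1 g2. g1 \<in> F ` B \<Longrightarrow> 0 \<le> T g1 g2"
    and T_exact: "T (F udag) (F udag) = 0"

definition noise_bounds ::
    "real \<Rightarrow> ('o \<Rightarrow> 'y \<Rightarrow> ereal) \<Rightarrow> ('y \<Rightarrow> 'y \<Rightarrow> ereal) \<Rightarrow> 'y \<Rightarrow> 'o \<Rightarrow> ('y \<Rightarrow> ereal) \<Rightarrow> bool" where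
  "noise_bounds Cerr S T gdag gobs err \<longleftrightarrow>
     (\<forall>g. 0 \<le> err g \<and>
          S gobs g \<le> ereal Cerr * T gdag g + ereal Cerr * err g \<and>
          T gdag g \<le> ereal Cerr * S gobs g + ereal Cerr * err g)"

datatype tcc_type = TypeA | TypeB

text \<open>The lower bound \<open>a / Ctc - \<eta> * b \<le> c\<close> is written as \<open>a / Ctc \<le> c + \<eta> * b\<close>,
  so that no difference of infinite values occurs; it is void if \<open>\<eta> * b = \<infinity>\<close>.\<close>

definition cone_bounds :: "real \<Rightarrow> real \<Rightarrow> ('x::real_normed_vector set) \<Rightarrow>
    ('x \<Rightarrow> 'y::real_normed_vector) \<Rightarrow> ('y \<Rightarrow> ereal) \<Rightarrow> bool" where
  "cone_bounds \<eta> Ctc B F m \<longleftrightarrow>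
     (\<forall>u\<in>B. \<forall>v\<in>B.
        ereal (1 / Ctc) * m (F v) \<le> m (linearization F u v) + ereal \<eta> * m (F u) \<and>
        m (linearization F u v) \<le> ereal Ctc * m (F v) + ereal \<eta> * m (F u))"

definition tangential_cone :: "tcc_type \<Rightarrow> real \<Rightarrow> real \<Rightarrow> ('x::real_normed_vector set) \<Rightarrow>
    ('x \<Rightarrow> 'y::real_normed_vector) \<Rightarrow> 'o set \<Rightarrow> ('o \<Rightarrow> 'y \<Rightarrow> ereal) \<Rightarrow> ('y \<Rightarrow> 'y \<Rightarrow> ereal) \<Rightarrow>
    'y \<Rightarrow> bool" where
  "tangential_cone ty \<eta> Ctc B F Yobs S T gdag \<longleftrightarrow>
     (case ty of
        TypeA \<Rightarrow> \<forall>gobs\<in>Yobs. cone_bounds \<eta> Ctc B F (S gobs)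
      | TypeB \<Rightarrow> cone_bounds \<eta> Ctc B F (T gdag))"

text \<open>For \<open>D = \<infinity>\<close>, i.e. outside the effective domain of \<open>R\<close>, the right-hand side of the source
  condition has no meaning (its value under the conventions of type \<^typ>\<open>ereal\<close> would be \<open>0\<close>),
  and nothing is required there.\<close>

definition multiplicative_vsc :: "real \<Rightarrow> (real \<Rightarrow> real) \<Rightarrow> 'x::real_normed_vector set \<Rightarrow>
    ('x \<Rightarrow> 'y) \<Rightarrow> ('x \<Rightarrow> ereal) \<Rightarrow> ('y \<Rightarrow> 'y \<Rightarrow> ereal) \<Rightarrow> 'x \<Rightarrow> ('x \<Rightarrow>\<^sub>L real) \<Rightarrow> bool" where
  "multiplicative_vsc \<beta> \<phi> B F R T udag ustar \<longleftrightarrow>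
     ustar \<in> subdifferential R udag \<and>
     (\<forall>u\<in>B. let D = bregman R ustar u udag in
        D \<noteq> \<infinity> \<longrightarrow>
        ereal (blinfun_apply ustar (udag - u)) \<le>
          (if D = 0 then 0
           else ereal (\<beta> * sqrt (real_of_ereal D)) * ext_inf \<phi> (T (F udag) (F u) / D)))"

definition regularization_parameters :: "(nat \<Rightarrow> real) \<Rightarrow> real \<Rightarrow> bool" where
  "regularization_parameters \<alpha> Cdec \<longleftrightarrow>
     \<alpha> 0 \<le> 1 \<and> (\<forall>n. 0 < \<alpha> n) \<and> \<alpha> \<longlonglongrightarrow> 0 \<and>
     (\<forall>n. 1 \<le> \<alpha> n / \<alpha> (Suc n) \<and> \<alpha> n / \<alpha> (Suc n) \<le> Cdec)"

definition newton_iterates :: "(nat \<Rightarrow> real) \<Rightarrow> 'x::real_normed_vector set \<Rightarrow>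
    ('x \<Rightarrow> 'y::real_normed_vector) \<Rightarrow> ('x \<Rightarrow> ereal) \<Rightarrow> ('o \<Rightarrow> 'y \<Rightarrow> ereal) \<Rightarrow> 'o \<Rightarrow> 'x \<Rightarrow>
    (nat \<Rightarrow> 'x) \<Rightarrow> bool" where
  "newton_iterates \<alpha> B F R S gobs u0 u \<longleftrightarrow>
     u 0 = u0 \<and>
     (\<forall>n. is_arg_min (\<lambda>v. S gobs (linearization F (u n) v) + ereal (\<alpha> n) * R v)
            (\<lambda>v. v \<in> B) (u (Suc n)))"

definition err_seq :: "tcc_type \<Rightarrow> real \<Rightarrow> real \<Rightarrow> real \<Rightarrow>
    ('x::real_normed_vector \<Rightarrow> 'y::real_normed_vector) \<Rightarrow> 'x \<Rightarrow> ('y \<Rightarrow> ereal) \<Rightarrow> (nat \<Rightarrow> 'x) \<Rightarrow>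
    nat \<Rightarrow> ereal" where
  "err_seq ty \<eta> Cerr Ctc F udag err u n =
     (case ty of
        TypeA \<Rightarrow> ereal (1 / Cerr) * err (F (u (Suc n))) + ereal (2 * \<eta> * Ctc) * err (F (u n))
                  + ereal (Ctc * Cerr) * err (F udag)
      | TypeB \<Rightarrow> err (linearization F (u n) (u (Suc n)))
                  + ereal Cerr * err (linearization F (u n) udag))"

text \<open>The stopping index is \<open>\<infinity>\<close> if the criterion is never met.\<close>

definition stopping_index :: "(real \<Rightarrow> real) \<Rightarrow> (nat \<Rightarrow> real) \<Rightarrow> real \<Rightarrow> (nat \<Rightarrow> ereal) \<Rightarrow> enat" where
  "stopping_index \<phi> \<alpha> \<tau> e = Inf (enat ` {n. ereal (Theta \<phi> (\<alpha> n)) \<le> ereal \<tau> * e n})"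

end

theory Submission
  imports Defs
begin

text \<open>
  Write \<open>d\<^sub>n\<close> for the Bregman distance of \<open>u\<^sub>n\<close> to the exact solution and \<open>t\<^sub>n\<close> for its misfit
  \<open>T (F udag) (F u\<^sub>n)\<close>, and let \<open>c = Ctc Cerr\<close>. Comparing the minimizer \<open>u\<^sub>n\<^sub>+\<^sub>1\<close> with the exact
  solution in the \<open>n\<close>-th penalized problem, and replacing the linearized misfits by nonlinear ones
  with the tangential cone condition, gives for both types of this condition
  \<open>\<alpha>\<^sub>n d\<^sub>n\<^sub>+\<^sub>1 + t\<^sub>n\<^sub>+\<^sub>1 / c \<le> 2 \<eta> Cerr t\<^sub>n + Cerr err\<^sub>n + \<alpha>\<^sub>n \<langle>u*, u\<dagger> - u\<^sub>n\<^sub>+\<^sub>1\<rangle>\<close>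
  (\<open>newton_step_inequality\<close>).

  The source condition bounds the last term by
  \<open>\<alpha>\<^sub>n \<beta> sqrt d\<^sub>n\<^sub>+\<^sub>1 \<phi> (t\<^sub>n\<^sub>+\<^sub>1 / d\<^sub>n\<^sub>+\<^sub>1)\<close>. If the quotient is at most
  \<open>\<alpha>\<^sub>n\<close>, then monotonicity of \<open>\<phi>\<close> replaces it by \<open>\<alpha>\<^sub>n\<close> and Young's inequality splits off
  \<open>\<alpha>\<^sub>n d\<^sub>n\<^sub>+\<^sub>1 / 2\<close>; otherwise the decrease of \<open>\<phi> t / sqrt t\<close> makes the Bregman distance cancel and
  Young's inequality splits off \<open>t\<^sub>n\<^sub>+\<^sub>1 / (2 c)\<close>. In both cases what remains is a multiple of
  \<open>\<Theta>(\<alpha>\<^sub>n)\<close> depending only on \<open>c\<close> and \<open>\<beta>\<close> (\<open>source_term_absorption\<close>).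

  If \<open>\<tau> \<ge> Cerr\<close>, then before the stopping index the noise term is at most \<open>\<Theta>(\<alpha>\<^sub>n)\<close>, and for exact data it vanishes.
  Hence, if \<open>t\<^sub>n \<le> K \<Theta>(\<alpha>\<^sub>n)\<close> and \<open>\<eta> K\<close> is small, then \<open>t\<^sub>n\<^sub>+\<^sub>1\<close> and \<open>\<alpha>\<^sub>n d\<^sub>n\<^sub>+\<^sub>1\<close> are bounded by a
  multiple of \<open>\<Theta>(\<alpha>\<^sub>n)\<close> that does not involve \<open>K\<close>, and a large \<open>K\<close> closes the induction
  (\<open>newton_rates\<close>). At the stopping index the inequality \<open>\<Theta>(\<alpha>\<^sub>N) \<le> \<tau> err\<^sub>N\<close> turns these rates
  into rates in terms of the noise (\<open>sq_le_ext_inf_Theta_inv\<close>).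
\<close>

section \<open>Index functions growing no faster than the square root\<close>

locale sqrt_dominated_index_function =
  fixes \<phi> :: "real \<Rightarrow> real"
  assumes index: "index_function \<phi>"
    and pos: "\<And>t. 0 < t \<Longrightarrow> 0 < \<phi> t"
    and ratio_antimono: "antimono_on {0<..} (\<lambda>t. \<phi> t / sqrt t)"
begin

lemma nonneg: "0 \<le> t \<Longrightarrow> 0 \<le> \<phi> t"
  using index by (auto simp: index_function_def)

lemma mono: "0 \<le> s \<Longrightarrow> s \<le> t \<Longrightarrow> \<phi> s \<le> \<phi> t"
  using index by (auto simp: index_function_def monotone_on_def)

lemma sq_mono: "0 \<le> s \<Longrightarrow> s \<le> t \<Longrightarrow> (\<phi> s)\<^sup>2 \<le> (\<phi> t)\<^sup>2"
  by (intro power_mono mono nonneg) auto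

lemma sqrt_growth:
  assumes "0 < s" "s \<le> t"
  shows "\<phi> t \<le> sqrt (t / s) * \<phi> s"
proof -
  have "\<phi> t / sqrt t \<le> \<phi> s / sqrt s"
    using monotone_onD[OF ratio_antimono, of s t] assms by auto
  with assms show ?thesis
    by (simp add: real_sqrt_divide field_simps)
qed

lemma sq_growth:
  assumes "0 < s" "s \<le> t"
  shows "(\<phi> t)\<^sup>2 \<le> t / s * (\<phi> s)\<^sup>2"
proof -
  have "(\<phi> t)\<^sup>2 \<le> (sqrt (t / s) * \<phi> s)\<^sup>2"
    using sqrt_growth[OF assms] nonneg[of t] assms by (intro power_mono) auto
  with assms show ?thesis
    by (simp add: power_mult_distrib)
qed

lemma Theta_pos: "0 < t \<Longrightarrow> 0 < Theta \<phi> t"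
  using pos[of t] by (simp add: Theta_def)

lemma Theta_nonneg: "0 \<le> t \<Longrightarrow> 0 \<le> Theta \<phi> t"
  by (simp add: Theta_def)

lemma Theta_mono: "0 \<le> s \<Longrightarrow> s \<le> t \<Longrightarrow> Theta \<phi> s \<le> Theta \<phi> t"
  unfolding Theta_def by (intro mult_mono sq_mono) auto

text \<open>Together with \<open>sq_growth\<close> this bounds the price of replacing \<open>\<alpha>\<^sub>n\<close> by \<open>\<alpha>\<^sub>n\<^sub>+\<^sub>1\<close> in the rates by
  powers of the constant \<open>Cdec\<close>.\<close>

lemma Theta_growth:
  assumes "0 < s" "s \<le> t"
  shows "Theta \<phi> t \<le> (t / s)\<^sup>2 * Theta \<phi> s"
proof -
  have "t * (\<phi> t)\<^sup>2 \<le> t * (t / s * (\<phi> s)\<^sup>2)"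
    using sq_growth[OF assms] assms by (intro mult_left_mono) auto
  also have "\<dots> = (t / s)\<^sup>2 * (s * (\<phi> s)\<^sup>2)"
    using assms by (simp add: power2_eq_square)
  finally show ?thesis by (simp add: Theta_def)
qed

text \<open>Surjectivity of \<open>\<Theta>\<close> onto the half-line: the intermediate value theorem applies because
  \<open>\<Theta>(t) \<ge> t \<phi>(1)\<^sup>2\<close> for \<open>t \<ge> 1\<close>, so that \<open>\<Theta>\<close> is unbounded.\<close>

lemma Theta_inv:
  assumes "0 \<le> x"
  shows "0 \<le> Theta_inv \<phi> x" and "Theta \<phi> (Theta_inv \<phi> x) = x"
proof -
  define b where "b = max 1 (x / (\<phi> 1)\<^sup>2)"
  have b: "1 \<le> b" "x / (\<phi> 1)\<^sup>2 \<le> b"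
    by (auto simp: b_def)
  have "x \<le> b * (\<phi> 1)\<^sup>2"
    using b(2) pos[of 1] by (simp add: pos_divide_le_eq)
  also have "\<dots> \<le> Theta \<phi> b"
    unfolding Theta_def using b(1) by (intro mult_left_mono sq_mono) auto
  finally have "x \<le> Theta \<phi> b" .
  moreover have "continuous_on {0..} (Theta \<phi>)"
    unfolding Theta_def
    using index by (intro continuous_intros) (auto simp: index_function_def)
  hence "continuous_on {0..b} (Theta \<phi>)"
    by (rule continuous_on_subset) auto
  ultimately obtain s where "0 \<le> s" "Theta \<phi> s = x"
    using IVT'[of "Theta \<phi>" 0 x b] assms b(1) by (auto simp: Theta_def)
  hence *: "x \<in> Theta \<phi> ` {0..}"
    by auto
  show "0 \<le> Theta_inv \<phi> x"
    using inv_into_into[OF *] by (simp add: Theta_inv_def)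
  show "Theta \<phi> (Theta_inv \<phi> x) = x"
    using f_inv_into_f[OF *] by (simp add: Theta_inv_def)
qed

lemma ext_inf_Theta_inv_infinity: "ext_inf (Theta_inv \<phi>) \<infinity> = \<infinity>"
proof -
  have "\<exists>x\<in>{0..}. ereal (real n) \<le> ereal (Theta_inv \<phi> x)" for n :: nat
  proof
    let ?x = "Theta \<phi> (real n) + 1"
    show x: "?x \<in> {0..}"
      using Theta_nonneg[of "real n"] by simp
    have "\<not> Theta_inv \<phi> ?x \<le> real n"
      using Theta_mono[of "Theta_inv \<phi> ?x" "real n"] Theta_inv[of ?x] x by auto
    thus "ereal (real n) \<le> ereal (Theta_inv \<phi> ?x)"
      by simp
  qed
  hence "(SUP x\<in>{0..}. ereal (Theta_inv \<phi> x)) = \<infinity>"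
    by (intro SUP_PInfty) auto
  thus ?thesis
    by (simp add: ext_inf_def)
qed

text \<open>Converts the rate \<open>\<phi>\<^sup>2(\<alpha>\<^sub>N)\<close> into a rate in the noise level. Let \<open>\<Theta>(s) = e\<close>. The case \<open>a \<le> s\<close> is
  monotonicity; for \<open>s < a\<close> the stopping inequality gives
  \<open>a \<phi>\<^sup>2(a) \<le> \<tau> s \<phi>\<^sup>2(s) \<le> \<tau> a \<phi>\<^sup>2(s)\<close>, which can be divided by \<open>a\<close>. For an infinite
  noise level the right-hand side contains the supremum of \<open>\<phi>\<close>.\<close>

lemma sq_le_ext_inf_Theta_inv:
  assumes "0 < a" "1 \<le> \<tau>" "0 \<le> e" and stop: "ereal (Theta \<phi> a) \<le> ereal \<tau> * e"
  shows "ereal ((\<phi> a)\<^sup>2) \<le> ereal \<tau> * (ext_inf \<phi> (ext_inf (Theta_inv \<phi>) e))\<^sup>2"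
proof (cases e)
  case (real x)
  define s where "s = Theta_inv \<phi> x"
  have "0 \<le> x"
    using real assms(3) by simp
  hence s: "0 \<le> s" "Theta \<phi> s = x"
    using Theta_inv by (auto simp: s_def)
  have "(\<phi> a)\<^sup>2 \<le> \<tau> * (\<phi> s)\<^sup>2"
  proof (cases "a \<le> s")
    case True
    hence "(\<phi> a)\<^sup>2 \<le> (\<phi> s)\<^sup>2"
      using assms(1) by (intro sq_mono) auto
    also have "\<dots> \<le> \<tau> * (\<phi> s)\<^sup>2"
      using mult_right_mono[OF assms(2), of "(\<phi> s)\<^sup>2"] by simp
    finally show ?thesis .
  next
    case False
    have "a * (\<phi> a)\<^sup>2 \<le> \<tau> * (s * (\<phi> s)\<^sup>2)"
      using stop s(2) real by (simp add: Theta_def)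
    also have "\<dots> \<le> \<tau> * (a * (\<phi> s)\<^sup>2)"
      using False assms(2) by (intro mult_left_mono mult_right_mono) auto
    finally have "a * (\<phi> a)\<^sup>2 \<le> a * (\<tau> * (\<phi> s)\<^sup>2)"
      by (simp add: ac_simps)
    thus ?thesis
      using assms(1) by simp
  qed
  thus ?thesis
    by (simp add: real ext_inf_def s_def)
next
  case PInf
  have le: "ereal (\<phi> a) \<le> ext_inf \<phi> \<infinity>"
    unfolding ext_inf_def using assms(1) by (auto intro!: SUP_upper)
  have "ereal ((\<phi> a)\<^sup>2) = (ereal (\<phi> a))\<^sup>2"
    by simp
  also have "\<dots> \<le> (ext_inf \<phi> \<infinity>)\<^sup>2"
    using le nonneg[of a] assms(1) unfolding power2_eq_square
    by (intro ereal_mult_mono) (auto intro: order_trans[OF _ le])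
  also have "\<dots> \<le> ereal \<tau> * (ext_inf \<phi> \<infinity>)\<^sup>2"
    using ereal_mult_right_mono[of 1 "ereal \<tau>" "(ext_inf \<phi> \<infinity>)\<^sup>2"] assms(2)
      le pos[OF assms(1)] order_trans[OF _ le, of 0]
    by (auto simp: power2_eq_square)
  finally show ?thesis
    by (simp add: PInf ext_inf_Theta_inv_infinity)
qed (use assms(3) in auto)

text \<open>\<open>X\<close> stands for the source term at an iterate with Bregman distance \<open>D\<close> and misfit \<open>t\<close>. Only
  half of \<open>a D + t / c\<close> is used up, so the other half survives as the quantity to be estimated.\<close>

lemma source_term_absorption:
  assumes "0 < a" "0 < c" "0 \<le> \<beta>" "0 \<le> D" "0 \<le> t"
    and X: "X \<le> (if D = 0 then 0 else \<beta> * sqrt D * \<phi> (t / D))"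
  shows "a * X \<le> a * D / 2 + t / (2 * c) + (c + 1) / 2 * \<beta>\<^sup>2 * Theta \<phi> a"
proof (cases "D = 0")
  case True
  have "a * X \<le> 0"
    using X True assms(1) by (simp add: mult_nonneg_nonpos)
  moreover have "0 \<le> (c + 1) / 2 * \<beta>\<^sup>2 * Theta \<phi> a"
    using assms Theta_nonneg[of a] by (intro mult_nonneg_nonneg) auto
  moreover have "0 \<le> t / (2 * c)"
    using assms by simp
  ultimately show ?thesis
    using True by simp
next
  case False
  hence D: "0 < D"
    using assms by simp
  have Xle: "a * X \<le> a * (\<beta> * sqrt D * \<phi> (t / D))"
    using X False assms(1) by (intro mult_left_mono) auto
  have rest: "0 \<le> a * D / 2" "0 \<le> t / (2 * c)"
    and coeff: "0 \<le> \<beta>\<^sup>2 * Theta \<phi> a / 2" "0 \<le> c * \<beta>\<^sup>2 * Theta \<phi> a / 2"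
    using assms Theta_nonneg[of a] by auto
  have split: "(c + 1) / 2 * \<beta>\<^sup>2 * Theta \<phi> a
      = c * \<beta>\<^sup>2 * Theta \<phi> a / 2 + \<beta>\<^sup>2 * Theta \<phi> a / 2"
    by (simp add: field_simps)
  show ?thesis
  proof (cases "t / D \<le> a")
    case True
    have "\<beta> * sqrt D * \<phi> (t / D) \<le> \<beta> * sqrt D * \<phi> a"
      using True assms D by (intro mult_left_mono mono) auto
    also have "\<dots> \<le> ((sqrt D)\<^sup>2 + (\<beta> * \<phi> a)\<^sup>2) / 2"
      using sum_squares_bound[of "sqrt D" "\<beta> * \<phi> a"] by (simp add: ac_simps)
    also have "\<dots> = D / 2 + \<beta>\<^sup>2 * (\<phi> a)\<^sup>2 / 2"
      using D by (simp add: power_mult_distrib field_simps)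
    finally have "a * (\<beta> * sqrt D * \<phi> (t / D)) \<le> a * (D / 2 + \<beta>\<^sup>2 * (\<phi> a)\<^sup>2 / 2)"
      using assms(1) by (intro mult_left_mono) auto
    also have "\<dots> = a * D / 2 + \<beta>\<^sup>2 * Theta \<phi> a / 2"
      by (simp add: Theta_def field_simps)
    finally show ?thesis
      using Xle rest coeff split by linarith
  next
    case False
    \<comment> \<open>The factor \<open>sqrt D\<close> cancels against the square-root growth of \<open>\<phi>\<close>; Young's inequality for
      \<open>?x * ?y\<close> is weighted by \<open>c\<close> to use up exactly half of \<open>t / c\<close>.\<close>
    let ?x = "sqrt t" and ?y = "\<beta> * \<phi> a * sqrt a"
    have "\<beta> * sqrt D * \<phi> (t / D) \<le> \<beta> * sqrt D * (sqrt (t / D / a) * \<phi> a)"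
      using False assms D by (intro mult_left_mono sqrt_growth) auto
    also have "\<dots> = \<beta> * (sqrt t / sqrt a) * \<phi> a"
      using D assms(1) by (simp add: real_sqrt_divide real_sqrt_mult field_simps)
    finally have "a * (\<beta> * sqrt D * \<phi> (t / D)) \<le> a * (\<beta> * (sqrt t / sqrt a) * \<phi> a)"
      using assms(1) by (intro mult_left_mono) auto
    also have "\<dots> = (a / sqrt a) * (sqrt t * \<beta> * \<phi> a)"
      by simp
    also have "a / sqrt a = sqrt a"
      using assms(1) by (simp add: real_div_sqrt)
    also have "sqrt a * (sqrt t * \<beta> * \<phi> a) = ?x * ?y"
      by simp
    also have "\<dots> = 2 * ?x * (c * ?y) / (2 * c)"
      using assms(2) by simp
    also have "\<dots> \<le> (?x\<^sup>2 + (c * ?y)\<^sup>2) / (2 * c)"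
      using assms(2) sum_squares_bound[of ?x "c * ?y"] by (intro divide_right_mono) auto
    also have "\<dots> = t / (2 * c) + c * \<beta>\<^sup>2 * Theta \<phi> a / 2"
      using assms(1,2,5) by (simp add: Theta_def power_mult_distrib field_simps power2_eq_square)
    finally show ?thesis
      using Xle rest coeff split by linarith
  qed
qed

end

section \<open>One Newton step\<close>

text \<open>The noise bounds and the cone condition, without the minimization: an upper bound for the data
  fidelity of the linearization at the exact solution and a lower bound at the next iterate. The
  two types of the cone condition distribute the residual and the noise differently between the
  remainders \<open>a\<close> and \<open>b\<close>, and only the sum of these has a common bound. The lower bound is stated
  as an upper bound for the misfit, so that no infinite values are subtracted.\<close>

lemma linearized_misfit_gap:
  fixes Cerr Ctc \<eta> t e :: real
  assumes const: "1 \<le> Cerr" "1 \<le> Ctc" "0 \<le> \<eta>"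
    and setting: "newton_setting B F R Yobs S T udag"
    and cone: "tangential_cone ty \<eta> Ctc B F Yobs S T (F udag)"
    and noise: "noise_bounds Cerr S T (F udag) gobs err"
    and gobs: "gobs \<in> Yobs"
    and B: "u n \<in> B" "u (Suc n) \<in> B"
    and t: "T (F udag) (F (u n)) = ereal t"
    and e: "err_seq ty \<eta> Cerr Ctc F udag err u n = ereal e"
  obtains a b where
    "S gobs (linearization F (u n) udag) \<le> ereal a"
    "T (F udag) (F (u (Suc n)))
       \<le> ereal (Ctc * Cerr) * (S gobs (linearization F (u n) (u (Suc n))) + ereal b)"
    "a + b \<le> 2 * \<eta> * Cerr * t + Cerr * e"
proof -
  interpret newton_setting B F R Yobs S T udag
    by (fact setting)
  define v w where "v = u n" and "w = u (Suc n)"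
  define lin where "lin = linearization F v"
  note defs = v_def w_def lin_def
  have t0: "0 \<le> t"
    using T_range[of "F udag" "F v"] udag_in_B t by (auto simp: defs)
  have err0: "0 \<le> err g" for g
    using noise by (auto simp: noise_bounds_def)
  have up: "S gobs g \<le> ereal Cerr * T (F udag) g + ereal Cerr * err g" for g
    using noise by (auto simp: noise_bounds_def)
  have lo: "T (F udag) g \<le> ereal Cerr * S gobs g + ereal Cerr * err g" for g
    using noise by (auto simp: noise_bounds_def)
  have Sm: "S gobs g \<noteq> -\<infinity>" for g
    using S_range gobs by auto
  have Tv: "T (F udag) (F v) = ereal t"
    using t by (simp add: defs)
  show thesis
  proof (cases ty)
    case TypeA
    have cb: "cone_bounds \<eta> Ctc B F (S gobs)"
      using cone gobs TypeA by (auto simp: tangential_cone_def)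
    have lower: "ereal (1 / Ctc) * S gobs (F w) \<le> S gobs (lin w) + ereal \<eta> * S gobs (F v)"
      using cb B by (auto simp: cone_bounds_def defs)
    have upper: "S gobs (lin udag) \<le> ereal Ctc * S gobs (F udag) + ereal \<eta> * S gobs (F v)"
      using cb B udag_in_B by (auto simp: cone_bounds_def defs)
    have ee: "ereal (1 / Cerr) * err (F w) + ereal (2 * \<eta> * Ctc) * err (F v)
        + ereal (Ctc * Cerr) * err (F udag) = ereal e"
      using e TypeA by (simp add: err_seq_def defs)
    obtain e1 where e1: "err (F w) = ereal e1"
      using ee err0[of "F w"] err0[of "F v"] err0[of "F udag"] const
      by (cases "err (F w)") auto
    obtain e3 where e3: "err (F udag) = ereal e3"
      using ee err0[of "F w"] err0[of "F v"] err0[of "F udag"] const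
      by (cases "err (F udag)") auto
    \<comment> \<open>For \<open>\<eta> = 0\<close> the error at \<open>F v\<close> may be infinite although the total error is finite;
      only its product with \<open>\<eta>\<close> is always a real number.\<close>
    obtain p where p: "ereal \<eta> * err (F v) = ereal p"
      using ee err0[of "F w"] err0[of "F v"] err0[of "F udag"] const
      by (cases "err (F v)"; cases "\<eta> = 0") (auto simp: zero_ereal_def[symmetric])
    have p0: "0 \<le> p"
      using p err0[of "F v"] const(3)
      by (metis ereal_0_le_mult ereal_less_eq(5))
    have "ereal (2 * \<eta> * Ctc) * err (F v) = ereal (2 * Ctc) * (ereal \<eta> * err (F v))"
      by (simp add: mult.assoc[symmetric] mult.commute)
    hence ereal_e: "e = e1 / Cerr + 2 * Ctc * p + Ctc * Cerr * e3"
      using ee e1 e3 p by simp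
    have Sv: "ereal \<eta> * S gobs (F v) \<le> ereal (\<eta> * Cerr * t + Cerr * p)"
    proof (cases "\<eta> = 0")
      case True
      thus ?thesis
        using p0 const by (simp add: zero_ereal_def[symmetric])
    next
      case False
      then obtain q where "err (F v) = ereal q"
        using p const(3) by (cases "err (F v)") auto
      moreover from this have "p = \<eta> * q"
        using p by simp
      moreover have "ereal \<eta> * S gobs (F v) \<le> ereal \<eta> * (ereal (Cerr * t + Cerr * q))"
        using up[of "F v"] Tv \<open>err (F v) = _\<close> const(3) by (intro ereal_mult_left_mono) auto
      ultimately show ?thesis
        by (simp add: algebra_simps)
    qed
    have Sd: "S gobs (F udag) \<le> ereal (Cerr * e3)"
      using up[of "F udag"] T_exact e3 by (simp add: zero_ereal_def[symmetric])
    show thesis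
    proof (rule that)
      show "S gobs (linearization F (u n) udag)
          \<le> ereal (Ctc * Cerr * e3 + (\<eta> * Cerr * t + Cerr * p))"
      proof -
        have "ereal Ctc * S gobs (F udag) \<le> ereal Ctc * ereal (Cerr * e3)"
          using Sd const by (intro ereal_mult_left_mono) auto
        hence "ereal Ctc * S gobs (F udag) + ereal \<eta> * S gobs (F v)
            \<le> ereal Ctc * ereal (Cerr * e3) + ereal (\<eta> * Cerr * t + Cerr * p)"
          using Sv by (rule add_mono)
        with upper show ?thesis
          by (simp add: defs mult.assoc)
      qed
      show "T (F udag) (F (u (Suc n))) \<le> ereal (Ctc * Cerr) *
          (S gobs (linearization F (u n) (u (Suc n))) + ereal (\<eta> * Cerr * t + Cerr * p + e1 / Ctc))"
      proof (cases "S gobs (lin w)")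
        case (real \<sigma>)
        have "ereal (1 / Ctc) * S gobs (F w) \<le> ereal (\<sigma> + (\<eta> * Cerr * t + Cerr * p))"
          using lower add_left_mono[OF Sv, of "S gobs (lin w)"] real by simp
        moreover from this obtain s where s: "S gobs (F w) = ereal s"
          using Sm[of "F w"] const by (cases "S gobs (F w)") auto
        ultimately have "s / Ctc \<le> \<sigma> + (\<eta> * Cerr * t + Cerr * p)"
          by simp
        hence "s \<le> Ctc * (\<sigma> + (\<eta> * Cerr * t + Cerr * p))"
          using const by (simp add: pos_divide_le_eq mult.commute)
        hence "Cerr * s + Cerr * e1 \<le> Cerr * (Ctc * (\<sigma> + (\<eta> * Cerr * t + Cerr * p))) + Cerr * e1"
          using const by simp
        also have "\<dots> = Ctc * Cerr * (\<sigma> + (\<eta> * Cerr * t + Cerr * p + e1 / Ctc))"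
          using const by (simp add: field_simps)
        finally have "ereal (Cerr * s + Cerr * e1)
            \<le> ereal (Ctc * Cerr * (\<sigma> + (\<eta> * Cerr * t + Cerr * p + e1 / Ctc)))"
          by simp
        moreover have "T (F udag) (F w) \<le> ereal (Cerr * s + Cerr * e1)"
          using lo[of "F w"] s e1 by simp
        ultimately have "T (F udag) (F w)
            \<le> ereal (Ctc * Cerr * (\<sigma> + (\<eta> * Cerr * t + Cerr * p + e1 / Ctc)))"
          by (rule order_trans[rotated])
        thus ?thesis
          using real by (simp add: defs)
      next
        case PInf
        thus ?thesis
          using const by (simp add: defs)
      next
        case MInf
        thus ?thesis
          using Sm by auto
      qed
      have e10: "0 \<le> e1" and e30: "0 \<le> e3"
        using err0[of "F w"] err0[of "F udag"] e1 e3 by auto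
      have "e1 / Ctc \<le> e1 / 1"
        using const e10 by (intro divide_left_mono) auto
      moreover have "2 * (Cerr * p) \<le> 2 * (Ctc * (Cerr * p))"
        using mult_right_mono[of 1 Ctc "Cerr * p"] const p0 by simp
      moreover have "Ctc * Cerr * e3 \<le> Cerr * (Ctc * Cerr * e3)"
        using mult_right_mono[of 1 Cerr "Ctc * Cerr * e3"] const e30 by simp
      moreover have "Cerr * e = e1 + 2 * (Ctc * (Cerr * p)) + Cerr * (Ctc * Cerr * e3)"
        using const by (simp add: ereal_e field_simps)
      ultimately show "Ctc * Cerr * e3 + (\<eta> * Cerr * t + Cerr * p) + (\<eta> * Cerr * t + Cerr * p + e1 / Ctc)
          \<le> 2 * \<eta> * Cerr * t + Cerr * e"
        by simp
    qed
  next
    case TypeB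
    have cb: "cone_bounds \<eta> Ctc B F (T (F udag))"
      using cone TypeB by (auto simp: tangential_cone_def)
    have lower: "ereal (1 / Ctc) * T (F udag) (F w) \<le> T (F udag) (lin w) + ereal (\<eta> * t)"
      using cb B Tv by (auto simp: cone_bounds_def defs)
    have "T (F udag) (lin udag) \<le> ereal Ctc * T (F udag) (F udag) + ereal (\<eta> * t)"
      using cb B udag_in_B Tv by (auto simp: cone_bounds_def defs)
    hence upper: "T (F udag) (lin udag) \<le> ereal (\<eta> * t)"
      using T_exact by simp
    have ee: "err (lin w) + ereal Cerr * err (lin udag) = ereal e"
      using e TypeB by (simp add: err_seq_def defs)
    obtain e1 where e1: "err (lin w) = ereal e1"
      using ee err0[of "lin w"] err0[of "lin udag"] const
      by (cases "err (lin w)") auto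
    obtain e2 where e2: "err (lin udag) = ereal e2"
      using ee err0[of "lin w"] err0[of "lin udag"] const
      by (cases "err (lin udag)") auto
    have e_eq: "e = e1 + Cerr * e2"
      using ee e1 e2 by simp
    show thesis
    proof (rule that)
      have "ereal Cerr * T (F udag) (lin udag) \<le> ereal Cerr * ereal (\<eta> * t)"
        using upper const by (intro ereal_mult_left_mono) auto
      hence "ereal Cerr * T (F udag) (lin udag) + ereal Cerr * err (lin udag)
          \<le> ereal Cerr * ereal (\<eta> * t) + ereal (Cerr * e2)"
        using e2 by (intro add_mono) auto
      thus "S gobs (linearization F (u n) udag) \<le> ereal (Cerr * (\<eta> * t) + Cerr * e2)"
        using up[of "lin udag"] by (simp add: defs)
      show "T (F udag) (F (u (Suc n))) \<le> ereal (Ctc * Cerr) *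
          (S gobs (linearization F (u n) (u (Suc n))) + ereal (e1 + \<eta> * t / Cerr))"
      proof (cases "S gobs (lin w)")
        case (real \<sigma>)
        have "T (F udag) (lin w) \<le> ereal (Cerr * \<sigma> + Cerr * e1)"
          using lo[of "lin w"] real e1 by simp
        hence "ereal (1 / Ctc) * T (F udag) (F w) \<le> ereal (Cerr * \<sigma> + Cerr * e1 + \<eta> * t)"
          using lower add_right_mono[of "T (F udag) (lin w)" _ "ereal (\<eta> * t)"]
          by (metis order_trans plus_ereal.simps(1))
        moreover from this obtain s where s: "T (F udag) (F w) = ereal s"
          using T_range[of "F udag" "F w"] udag_in_B const by (cases "T (F udag) (F w)") auto
        ultimately have "s / Ctc \<le> Cerr * \<sigma> + Cerr * e1 + \<eta> * t"
          by simp
        hence "s \<le> Ctc * (Cerr * \<sigma> + Cerr * e1 + \<eta> * t)"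
          using const by (simp add: pos_divide_le_eq mult.commute)
        also have "\<dots> = Ctc * Cerr * (\<sigma> + (e1 + \<eta> * t / Cerr))"
          using const by (simp add: field_simps)
        finally show ?thesis
          using real s by (simp add: defs)
      next
        case PInf
        thus ?thesis
          using const by (simp add: defs)
      next
        case MInf
        thus ?thesis
          using Sm by auto
      qed
      have "0 \<le> e1"
        using err0[of "lin w"] e1 by simp
      moreover have "0 \<le> e2"
        using err0[of "lin udag"] e2 by simp
      ultimately have "0 \<le> e"
        using const by (simp add: e_eq)
      hence "e \<le> Cerr * e"
        using const mult_right_mono[of 1 Cerr e] by simp
      moreover have "\<eta> * t / Cerr \<le> \<eta> * t"
        using const t0 divide_left_mono[of 1 Cerr "\<eta> * t"] by simp
      moreover have "\<eta> * t \<le> Cerr * (\<eta> * t)"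
        using const t0 mult_right_mono[of 1 Cerr "\<eta> * t"] by simp
      ultimately show "Cerr * (\<eta> * t) + Cerr * e2 + (e1 + \<eta> * t / Cerr)
          \<le> 2 * \<eta> * Cerr * t + Cerr * e"
        by (simp add: e_eq)
    qed
  qed
qed

text \<open>The iterate does no worse than the exact solution in the \<open>n\<close>-th penalized problem, and the
  penalty difference between them is the Bregman distance minus the source term. As the functional is
  finite at the exact solution and neither \<open>S\<close> nor \<open>R\<close> takes the value \<open>-\<infinity>\<close>, all quantities at the
  new iterate are finite.\<close>

lemma newton_step_inequality:
  fixes Cerr Ctc \<eta> t e :: real
  assumes const: "1 \<le> Cerr" "1 \<le> Ctc" "0 \<le> \<eta>"
    and setting: "newton_setting B F R Yobs S T udag"
    and sub: "ustar \<in> subdifferential R udag"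
    and cone: "tangential_cone ty \<eta> Ctc B F Yobs S T (F udag)"
    and noise: "noise_bounds Cerr S T (F udag) gobs err"
    and gobs: "gobs \<in> Yobs"
    and iter: "newton_iterates \<alpha> B F R S gobs u0 u"
    and \<alpha>: "0 < \<alpha> n"
    and B: "u n \<in> B"
    and t: "T (F udag) (F (u n)) = ereal t"
    and e: "err_seq ty \<eta> Cerr Ctc F udag err u n = ereal e"
  obtains d t' where
    "bregman R ustar (u (Suc n)) udag = ereal d" "0 \<le> d"
    "T (F udag) (F (u (Suc n))) = ereal t'" "0 \<le> t'"
    "\<alpha> n * d + t' / (Ctc * Cerr)
       \<le> 2 * \<eta> * Cerr * t + Cerr * e + \<alpha> n * blinfun_apply ustar (udag - u (Suc n))"
proof -
  interpret newton_setting B F R Yobs S T udag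
    by (fact setting)
  define w where "w = u (Suc n)"
  have w: "w \<in> B"
    using iter by (auto simp: newton_iterates_def is_arg_min_def w_def)
  have min: "S gobs (linearization F (u n) w) + ereal (\<alpha> n) * R w
      \<le> S gobs (linearization F (u n) udag) + ereal (\<alpha> n) * R udag"
    using iter udag_in_B by (auto simp: newton_iterates_def is_arg_min_def w_def not_less)
  obtain a b where a: "S gobs (linearization F (u n) udag) \<le> ereal a"
    and b: "T (F udag) (F w)
       \<le> ereal (Ctc * Cerr) * (S gobs (linearization F (u n) w) + ereal b)"
    and ab: "a + b \<le> 2 * \<eta> * Cerr * t + Cerr * e"
    using linearized_misfit_gap[where u = u, OF const setting cone noise gobs B _ t e] w
    by (auto simp: w_def)
  have Rm: "R v \<noteq> -\<infinity>" for v
    using proper_convex_R by (auto simp: proper_convex_def)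
  have sub': "R udag + ereal (blinfun_apply ustar (v - udag)) \<le> R v" for v
    using sub by (auto simp: subdifferential_def)
  obtain v where "R v \<noteq> \<infinity>"
    using proper_convex_R by (auto simp: proper_convex_def)
  then obtain r where r: "R udag = ereal r"
    using sub'[of v] Rm[of udag] by (cases "R udag") auto
  obtain \<rho> where \<rho>: "S gobs (linearization F (u n) udag) = ereal \<rho>" "\<rho> \<le> a"
    using a S_range[OF gobs] by (cases "S gobs (linearization F (u n) udag)") auto
  obtain \<sigma> where \<sigma>: "S gobs (linearization F (u n) w) = ereal \<sigma>"
    using min \<rho> r Rm[of w] \<alpha> S_range[OF gobs]
    by (cases "S gobs (linearization F (u n) w)"; cases "R w") auto
  obtain q where q: "R w = ereal q"
    using min \<rho> r \<sigma> Rm[of w] \<alpha> by (cases "R w") auto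
  obtain t' where t': "T (F udag) (F w) = ereal t'"
    using b \<sigma> T_range[of "F udag" "F w"] udag_in_B by (cases "T (F udag) (F w)") auto
  define X where "X = blinfun_apply ustar (udag - w)"
  have X: "blinfun_apply ustar (w - udag) = - X"
    by (simp add: X_def blinfun.diff_right)
  show thesis
  proof (rule that)
    show "bregman R ustar (u (Suc n)) udag = ereal (q - r + X)"
      using q r X by (simp add: bregman_def w_def)
    show "0 \<le> q - r + X"
      using sub'[of w] q r X by simp
    show "T (F udag) (F (u (Suc n))) = ereal t'"
      using t' by (simp add: w_def)
    show "0 \<le> t'"
      using T_range[of "F udag" "F w"] udag_in_B t' by auto
    have "t' \<le> Ctc * Cerr * (\<sigma> + b)"
      using b \<sigma> t' by simp
    hence "t' / (Ctc * Cerr) \<le> \<sigma> + b"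
      using const by (simp add: pos_divide_le_eq mult.commute)
    moreover have "\<sigma> + \<alpha> n * q \<le> \<rho> + \<alpha> n * r"
      using min \<rho> \<sigma> q r by simp
    ultimately show "\<alpha> n * (q - r + X) + t' / (Ctc * Cerr)
       \<le> 2 * \<eta> * Cerr * t + Cerr * e + \<alpha> n * blinfun_apply ustar (udag - u (Suc n))"
      using \<rho>(2) ab by (simp add: X_def[symmetric] w_def[symmetric] algebra_simps)
  qed
qed

section \<open>Rates along the iteration and at the stopping index\<close>

text \<open>In a step starting from a residual \<open>t \<le> K \<Theta>(\<alpha>\<^sub>n)\<close>, smallness of \<open>\<eta> K\<close> and an error of
  at most \<open>\<Theta>(\<alpha>\<^sub>n) / Cerr\<close> leave a total of \<open>2 \<Theta>(\<alpha>\<^sub>n)\<close> besides the source term. That term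
  is bounded by half of the left-hand side plus another multiple of \<open>\<Theta>(\<alpha>\<^sub>n)\<close>, and this multiple does
  not depend on \<open>K\<close>. The cost of passing from \<open>\<alpha>\<^sub>n\<close> to \<open>\<alpha>\<^sub>n\<^sub>+\<^sub>1\<close> is at most
  \<open>Cdec\<^sup>2\<close>, so the choice of \<open>K\<close> made here reproduces the bound in the next step.\<close>

lemma (in sqrt_dominated_index_function) newton_rates:
  fixes Cerr Ctc Cdec \<beta> \<eta> K :: real
  assumes const: "1 \<le> Cerr" "1 \<le> Ctc" "0 \<le> \<beta>" "0 \<le> \<eta>"
    and par: "regularization_parameters \<alpha> Cdec"
    and K: "K = 2 * (Ctc * Cerr) * Cdec\<^sup>2 * (2 + (Ctc * Cerr + 1) / 2 * \<beta>\<^sup>2)"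
    and \<eta>: "\<eta> \<le> 1 / (2 * Cerr * K)"
    and setting: "newton_setting B F R Yobs S T udag"
    and vsc: "multiplicative_vsc \<beta> \<phi> B F R T udag ustar"
    and cone: "tangential_cone ty \<eta> Ctc B F Yobs S T (F udag)"
    and noise: "noise_bounds Cerr S T (F udag) gobs err"
    and gobs: "gobs \<in> Yobs"
    and iter: "newton_iterates \<alpha> B F R S gobs u0 u"
    and u0: "u0 \<in> B" "bregman R ustar u0 udag \<le> ereal (K * (\<phi> (\<alpha> 0))\<^sup>2)"
      "T (F udag) (F u0) \<le> ereal (K * Theta \<phi> (\<alpha> 0))"
    and err: "\<And>k. k < n \<Longrightarrow> ereal Cerr * err_seq ty \<eta> Cerr Ctc F udag err u k
                \<le> ereal (Theta \<phi> (\<alpha> k))"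
  shows "bregman R ustar (u n) udag \<le> ereal (K * (\<phi> (\<alpha> n))\<^sup>2) \<and>
         T (F udag) (F (u n)) \<le> ereal (K * Theta \<phi> (\<alpha> n))"
  using err
proof (induction n)
  case 0
  show ?case
    using iter u0 by (simp add: newton_iterates_def)
next
  case (Suc n)
  interpret newton_setting B F R Yobs S T udag
    by (fact setting)
  define c M where "c = Ctc * Cerr" and "M = 2 + (c + 1) / 2 * \<beta>\<^sup>2"
  have c: "1 \<le> c"
    using const mult_mono[of 1 Ctc 1 Cerr] by (simp add: c_def)
  have M: "2 \<le> M"
    using c by (simp add: M_def)
  have \<alpha>: "0 < \<alpha> k" "1 \<le> \<alpha> k / \<alpha> (Suc k)" "\<alpha> k / \<alpha> (Suc k) \<le> Cdec" for k
    using par by (auto simp: regularization_parameters_def)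
  have Cdec: "1 \<le> Cdec"
    using \<alpha>(2,3)[of 0] by linarith
  have K': "K = 2 * c * Cdec\<^sup>2 * M"
    by (simp add: K c_def M_def)
  have Kpos: "0 < K"
    using c M Cdec by (simp add: K')
  have \<alpha>_le: "\<alpha> (Suc n) \<le> \<alpha> n"
    using \<alpha>(2)[of n] \<alpha>(1)[of "Suc n"] by (simp add: pos_le_divide_eq)
  have uB: "u k \<in> B" for k
    using iter u0(1) by (cases k) (auto simp: newton_iterates_def is_arg_min_def)
  have IH: "T (F udag) (F (u n)) \<le> ereal (K * Theta \<phi> (\<alpha> n))"
    using Suc by simp
  then obtain t where t: "T (F udag) (F (u n)) = ereal t" "t \<le> K * Theta \<phi> (\<alpha> n)"
    using T_range[of "F udag" "F (u n)"] udag_in_B by (cases "T (F udag) (F (u n))") auto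
  have err0: "0 \<le> err g" for g
    using noise by (auto simp: noise_bounds_def)
  have e0: "0 \<le> err_seq ty \<eta> Cerr Ctc F udag err u n"
    using const err0 by (auto simp: err_seq_def split: tcc_type.split intro!: add_nonneg_nonneg)
  have en: "ereal Cerr * err_seq ty \<eta> Cerr Ctc F udag err u n \<le> ereal (Theta \<phi> (\<alpha> n))"
    using Suc.prems[of n] by simp
  then obtain e where e: "err_seq ty \<eta> Cerr Ctc F udag err u n = ereal e"
      "Cerr * e \<le> Theta \<phi> (\<alpha> n)"
    using e0 const by (cases "err_seq ty \<eta> Cerr Ctc F udag err u n") auto
  have sub: "ustar \<in> subdifferential R udag"
    using vsc by (simp add: multiplicative_vsc_def)
  obtain d t' where d: "bregman R ustar (u (Suc n)) udag = ereal d" "0 \<le> d"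
    and t': "T (F udag) (F (u (Suc n))) = ereal t'" "0 \<le> t'"
    and ineq: "\<alpha> n * d + t' / c
       \<le> 2 * \<eta> * Cerr * t + Cerr * e + \<alpha> n * blinfun_apply ustar (udag - u (Suc n))"
    using newton_step_inequality[OF const(1,2,4) setting sub cone noise gobs iter \<alpha>(1) uB t(1) e(1)]
    unfolding c_def by blast
  define X where "X = blinfun_apply ustar (udag - u (Suc n))"
  have "X \<le> (if d = 0 then 0 else \<beta> * sqrt d * \<phi> (t' / d))"
    using vsc uB[of "Suc n"] d t'
    by (auto simp: multiplicative_vsc_def Let_def X_def ext_inf_def dest!: bspec split: if_splits)
  hence absorb: "\<alpha> n * X \<le> \<alpha> n * d / 2 + t' / (2 * c) + (c + 1) / 2 * \<beta>\<^sup>2 * Theta \<phi> (\<alpha> n)"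
    using \<alpha>(1)[of n] c const(3) d(2) t'(2) by (intro source_term_absorption) auto
  have "2 * \<eta> * Cerr * t \<le> 2 * \<eta> * Cerr * (K * Theta \<phi> (\<alpha> n))"
    using t(2) const by (intro mult_left_mono) auto
  also have "\<dots> = (2 * Cerr * K * \<eta>) * Theta \<phi> (\<alpha> n)"
    by simp
  also have "\<dots> \<le> 1 * Theta \<phi> (\<alpha> n)"
    using \<eta> const Kpos \<alpha>(1)[of n] Theta_nonneg[of "\<alpha> n"]
    by (intro mult_right_mono) (auto simp: field_simps)
  finally have "2 * \<eta> * Cerr * t \<le> Theta \<phi> (\<alpha> n)"
    by simp
  moreover have "t' / c = 2 * (t' / (2 * c))"
    by simp
  moreover have "M * Theta \<phi> (\<alpha> n)
      = 2 * Theta \<phi> (\<alpha> n) + (c + 1) / 2 * \<beta>\<^sup>2 * Theta \<phi> (\<alpha> n)"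
    by (simp add: M_def algebra_simps)
  ultimately have main: "\<alpha> n * d / 2 + t' / (2 * c) \<le> M * Theta \<phi> (\<alpha> n)"
    using ineq absorb e(2) unfolding X_def[symmetric] by linarith
  have "\<alpha> n * d / 2 \<le> \<alpha> n * (M * (\<phi> (\<alpha> n))\<^sup>2)"
  proof -
    have "0 \<le> t' / (2 * c)"
      using t'(2) c by simp
    with main have "\<alpha> n * d / 2 \<le> M * Theta \<phi> (\<alpha> n)"
      by linarith
    thus ?thesis
      by (simp add: Theta_def mult.left_commute)
  qed
  hence "\<alpha> n * d \<le> \<alpha> n * (2 * M * (\<phi> (\<alpha> n))\<^sup>2)"
    by simp
  hence "d \<le> 2 * M * (\<phi> (\<alpha> n))\<^sup>2"
    using \<alpha>(1)[of n] by simp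
  also have "\<dots> \<le> 2 * M * (Cdec * (\<phi> (\<alpha> (Suc n)))\<^sup>2)"
    using order_trans[OF sq_growth[OF \<alpha>(1) \<alpha>_le] mult_right_mono[OF \<alpha>(3)]] M
    by (intro mult_left_mono) auto
  also have "\<dots> = (1 * Cdec) * (2 * M * (\<phi> (\<alpha> (Suc n)))\<^sup>2)"
    by simp
  also have "\<dots> \<le> (c * Cdec\<^sup>2) * (2 * M * (\<phi> (\<alpha> (Suc n)))\<^sup>2)"
    using c Cdec M self_le_power[of Cdec 2] by (intro mult_right_mono mult_mono) auto
  also have "\<dots> = K * (\<phi> (\<alpha> (Suc n)))\<^sup>2"
    by (simp add: K')
  finally have d_le: "d \<le> K * (\<phi> (\<alpha> (Suc n)))\<^sup>2" .
  have "t' / (2 * c) \<le> M * Theta \<phi> (\<alpha> n)"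
    using main mult_nonneg_nonneg[of "\<alpha> n" d] \<alpha>(1)[of n] d(2) by linarith
  hence "t' \<le> 2 * c * M * Theta \<phi> (\<alpha> n)"
    using c by (simp add: pos_divide_le_eq ac_simps)
  also have "\<dots> \<le> 2 * c * M * (Cdec\<^sup>2 * Theta \<phi> (\<alpha> (Suc n)))"
  proof -
    have "(\<alpha> n / \<alpha> (Suc n))\<^sup>2 * Theta \<phi> (\<alpha> (Suc n)) \<le> Cdec\<^sup>2 * Theta \<phi> (\<alpha> (Suc n))"
      using \<alpha>(2,3)[of n] \<alpha>(1)[of "Suc n"] Theta_nonneg[of "\<alpha> (Suc n)"]
      by (intro mult_right_mono power_mono) auto
    with Theta_growth[OF \<alpha>(1) \<alpha>_le] c M show ?thesis
      by (intro mult_left_mono) auto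
  qed
  also have "\<dots> = K * Theta \<phi> (\<alpha> (Suc n))"
    by (simp add: K')
  finally show ?case
    using d(1) t'(1) d_le by simp
qed

lemma stopping_index_not_met:
  assumes "enat n \<le> stopping_index \<phi> \<alpha> \<tau> e" "k < n"
  shows "ereal \<tau> * e k < ereal (Theta \<phi> (\<alpha> k))"
proof (rule ccontr)
  assume "\<not> ?thesis"
  hence "stopping_index \<phi> \<alpha> \<tau> e \<le> enat k"
    unfolding stopping_index_def by (intro Inf_lower) auto
  with assms have "enat n \<le> enat k"
    by (blast intro: order_trans)
  with assms(2) show False
    by simp
qed

lemma stopping_index_met:
  assumes "stopping_index \<phi> \<alpha> \<tau> e = enat N"
  shows "ereal (Theta \<phi> (\<alpha> N)) \<le> ereal \<tau> * e N"
proof -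
  let ?A = "enat ` {n. ereal (Theta \<phi> (\<alpha> n)) \<le> ereal \<tau> * e n}"
  have "?A \<noteq> {}"
  proof
    assume "?A = {}"
    hence "stopping_index \<phi> \<alpha> \<tau> e = \<infinity>"
      unfolding stopping_index_def by (simp add: Inf_enat_def)
    with assms show False
      by simp
  qed
  then obtain x where "x \<in> ?A"
    by (meson ex_in_conv)
  hence "Inf ?A \<in> ?A"
    by (rule wellorder_InfI)
  hence "enat N \<in> ?A"
    using assms by (simp only: stopping_index_def)
  thus ?thesis
    by auto
qed

theorem theorem2p3:
  fixes Cerr Ctc Cdec \<beta> :: real
    and \<phi> :: "real \<Rightarrow> real"
    and \<alpha> :: "nat \<Rightarrow> real"
  assumes "1 \<le> Cerr" and "1 \<le> Ctc" and "0 \<le> \<beta>"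
    and "index_function \<phi>" and "concave_on {0..} \<phi>" and "\<forall>t>0. 0 < \<phi> t"
    and "antimono_on {0<..} (\<lambda>t. \<phi> t / sqrt t)"
    and "regularization_parameters \<alpha> Cdec"
  shows "\<exists>\<eta>0>0. \<exists>D0>0. \<exists>T0>0. \<exists>\<tau>0\<ge>1.
    \<forall>(B :: 'x::banach set) (F :: 'x \<Rightarrow> 'y::banach) (R :: 'x \<Rightarrow> ereal)
      (Yobs :: 'o set) (S :: 'o \<Rightarrow> 'y \<Rightarrow> ereal) (T :: 'y \<Rightarrow> 'y \<Rightarrow> ereal)
      (udag :: 'x) (ustar :: 'x \<Rightarrow>\<^sub>L real) (as_obs :: 'y \<Rightarrow> 'o)
      (ty :: tcc_type) (\<eta> :: real) (u0 :: 'x).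
      newton_setting B F R Yobs S T udag \<and>
      multiplicative_vsc \<beta> \<phi> B F R T udag ustar \<and>
      tangential_cone ty \<eta> Ctc B F Yobs S T (F udag) \<and>
      0 \<le> \<eta> \<and> \<eta> \<le> \<eta>0 \<and>
      u0 \<in> B \<and> bregman R ustar u0 udag \<le> ereal D0 \<and> T (F udag) (F u0) \<le> ereal T0
      \<longrightarrow>
      (as_obs (F udag) \<in> Yobs \<and>
       noise_bounds Cerr S T (F udag) (as_obs (F udag)) (\<lambda>g. 0) \<longrightarrow>
       (\<exists>C>0. \<forall>u. newton_iterates \<alpha> B F R S (as_obs (F udag)) u0 u \<longrightarrow>
          (\<forall>n. bregman R ustar (u n) udag \<le> ereal (C * (\<phi> (\<alpha> n))\<^sup>2) \<and>
               T (F udag) (F (u n)) \<le> ereal (C * Theta \<phi> (\<alpha> n)))))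
      \<and>
      (\<forall>\<tau>\<ge>\<tau>0. \<exists>C>0. \<forall>gobs\<in>Yobs. \<forall>err u.
         noise_bounds Cerr S T (F udag) gobs err \<and>
         newton_iterates \<alpha> B F R S gobs u0 u \<longrightarrow>
         (let e = err_seq ty \<eta> Cerr Ctc F udag err u;
              nstar = stopping_index \<phi> \<alpha> \<tau> e
          in (\<forall>n. enat n \<le> nstar \<longrightarrow>
                bregman R ustar (u n) udag \<le> ereal (C * (\<phi> (\<alpha> n))\<^sup>2) \<and>
                T (F udag) (F (u n)) \<le> ereal (C * Theta \<phi> (\<alpha> n))) \<and>
             (\<forall>N. nstar = enat N \<longrightarrow>
                bregman R ustar (u N) udag
                  \<le> ereal C * (ext_inf \<phi> (ext_inf (Theta_inv \<phi>) (e N)))\<^sup>2 \<and>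
                T (F udag) (F (u N)) \<le> ereal C * e N)))"
proof -
  interpret sqrt_dominated_index_function \<phi>
    using assms by unfold_locales auto
  \<comment> \<open>The thresholds for the initial guess are those that start the induction with the constant \<open>K\<close>,
    and the threshold for \<open>\<tau>\<close> absorbs the factor \<open>Cerr\<close> in front of the noise term.\<close>
  define K where "K = 2 * (Ctc * Cerr) * Cdec\<^sup>2 * (2 + (Ctc * Cerr + 1) / 2 * \<beta>\<^sup>2)"
  have \<alpha>: "0 < \<alpha> n" for n
    using assms(8) by (auto simp: regularization_parameters_def)
  have "1 \<le> \<alpha> 0 / \<alpha> (Suc 0)" "\<alpha> 0 / \<alpha> (Suc 0) \<le> Cdec"
    using assms(8) by (auto simp: regularization_parameters_def)
  hence Cdec: "1 \<le> Cdec"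
    by linarith
  have K: "0 < K"
    using assms(1,2) Cdec by (simp add: K_def add_pos_nonneg)
  have thresholds: "0 < 1 / (2 * Cerr * K)" "0 < K * (\<phi> (\<alpha> 0))\<^sup>2" "0 < K * Theta \<phi> (\<alpha> 0)"
    using assms(1) K pos[OF \<alpha>[of 0]] Theta_pos[OF \<alpha>[of 0]] by auto
  show ?thesis
  proof (rule exI, rule conjI[OF thresholds(1)], rule exI, rule conjI[OF thresholds(2)],
      rule exI, rule conjI[OF thresholds(3)], rule exI, rule conjI[OF assms(1)],
      intro conjI allI impI, goal_cases)
    case (1 B F R Yobs S T udag ustar as_obs ty \<eta> u0)
    have setting: "newton_setting B F R Yobs S T udag"
      and vsc: "multiplicative_vsc \<beta> \<phi> B F R T udag ustar"
      and cone: "tangential_cone ty \<eta> Ctc B F Yobs S T (F udag)"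
      and \<eta>: "0 \<le> \<eta>" "\<eta> \<le> 1 / (2 * Cerr * K)"
      and u0: "u0 \<in> B" "bregman R ustar u0 udag \<le> ereal (K * (\<phi> (\<alpha> 0))\<^sup>2)"
        "T (F udag) (F u0) \<le> ereal (K * Theta \<phi> (\<alpha> 0))"
      using 1(1) by blast+
    note rates = newton_rates[OF assms(1-3) \<eta>(1) assms(8) K_def \<eta>(2) setting vsc cone _ _ _ u0]
    \<comment> \<open>For exact data the noise term vanishes, so there is no index at which the induction has to stop.\<close>
    have zero: "err_seq ty \<eta> Cerr Ctc F udag (\<lambda>g. 0) u k = 0" for u k
      by (auto simp: err_seq_def split: tcc_type.split)
    have "bregman R ustar (u n) udag \<le> ereal (K * (\<phi> (\<alpha> n))\<^sup>2) \<and>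
        T (F udag) (F (u n)) \<le> ereal (K * Theta \<phi> (\<alpha> n))"
      if "newton_iterates \<alpha> B F R S (as_obs (F udag)) u0 u" for u n
    proof (rule rates[where err = "\<lambda>g. 0"])
      show "noise_bounds Cerr S T (F udag) (as_obs (F udag)) (\<lambda>g. 0)" "as_obs (F udag) \<in> Yobs"
        using 1(2) by auto
      show "newton_iterates \<alpha> B F R S (as_obs (F udag)) u0 u"
        by (fact that)
      show "ereal Cerr * err_seq ty \<eta> Cerr Ctc F udag (\<lambda>g. 0) u k \<le> ereal (Theta \<phi> (\<alpha> k))"
        for k
        using Theta_nonneg[of "\<alpha> k"] \<alpha>[of k] by (simp add: zero)
    qed
    with K show ?case
      by (intro exI[of _ K]) simp
  next
    case (2 B F R Yobs S T udag ustar as_obs ty \<eta> u0 \<tau>)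
    have setting: "newton_setting B F R Yobs S T udag"
      and vsc: "multiplicative_vsc \<beta> \<phi> B F R T udag ustar"
      and cone: "tangential_cone ty \<eta> Ctc B F Yobs S T (F udag)"
      and \<eta>: "0 \<le> \<eta>" "\<eta> \<le> 1 / (2 * Cerr * K)"
      and u0: "u0 \<in> B" "bregman R ustar u0 udag \<le> ereal (K * (\<phi> (\<alpha> 0))\<^sup>2)"
        "T (F udag) (F u0) \<le> ereal (K * Theta \<phi> (\<alpha> 0))"
      using 2(1) by blast+
    note rates = newton_rates[OF assms(1-3) \<eta>(1) assms(8) K_def \<eta>(2) setting vsc cone _ _ _ u0]
    note \<tau> = 2(2)
    have \<tau>1: "1 \<le> \<tau>"
      using \<tau> assms(1) by simp
    have KK: "K \<le> K * \<tau>" "0 < K * \<tau>"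
      using K \<tau>1 by auto
    show ?case
    proof (rule exI[of _ "K * \<tau>"], intro conjI ballI allI impI KK(2), goal_cases)
      case (1 gobs err u)
      define e where "e = err_seq ty \<eta> Cerr Ctc F udag err u"
      have "0 \<le> err g" for g
        using 1 by (auto simp: noise_bounds_def)
      hence e0: "0 \<le> e k" for k
        using \<eta>(1) assms(1,2)
        by (auto simp: e_def err_seq_def split: tcc_type.split intro!: add_nonneg_nonneg)
      have rate_K: "bregman R ustar (u n) udag \<le> ereal (K * (\<phi> (\<alpha> n))\<^sup>2) \<and>
          T (F udag) (F (u n)) \<le> ereal (K * Theta \<phi> (\<alpha> n))"
        if n: "enat n \<le> stopping_index \<phi> \<alpha> \<tau> e" for n
      proof (rule rates)
        show "noise_bounds Cerr S T (F udag) gobs err" "gobs \<in> Yobs"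
          "newton_iterates \<alpha> B F R S gobs u0 u"
          using 1 by auto
        fix k
        assume "k < n"
        have "ereal Cerr * e k \<le> ereal \<tau> * e k"
          using \<tau> e0 by (intro ereal_mult_right_mono) auto
        also have "\<dots> \<le> ereal (Theta \<phi> (\<alpha> k))"
          using stopping_index_not_met[OF n \<open>k < n\<close>] by simp
        finally show "ereal Cerr * err_seq ty \<eta> Cerr Ctc F udag err u k
            \<le> ereal (Theta \<phi> (\<alpha> k))"
          by (simp add: e_def)
      qed
      have "bregman R ustar (u n) udag \<le> ereal (K * \<tau> * (\<phi> (\<alpha> n))\<^sup>2) \<and>
          T (F udag) (F (u n)) \<le> ereal (K * \<tau> * Theta \<phi> (\<alpha> n))"
        if n: "enat n \<le> stopping_index \<phi> \<alpha> \<tau> e" for n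
      proof -
        have "ereal (K * (\<phi> (\<alpha> n))\<^sup>2) \<le> ereal (K * \<tau> * (\<phi> (\<alpha> n))\<^sup>2)"
          "ereal (K * Theta \<phi> (\<alpha> n)) \<le> ereal (K * \<tau> * Theta \<phi> (\<alpha> n))"
          using KK(1) Theta_nonneg[of "\<alpha> n"] \<alpha>[of n] by (auto intro!: mult_right_mono)
        with rate_K[OF n] show ?thesis
          by (blast intro: order_trans)
      qed
      moreover have "bregman R ustar (u N) udag
            \<le> ereal (K * \<tau>) * (ext_inf \<phi> (ext_inf (Theta_inv \<phi>) (e N)))\<^sup>2 \<and>
          T (F udag) (F (u N)) \<le> ereal (K * \<tau>) * e N"
        if N: "stopping_index \<phi> \<alpha> \<tau> e = enat N" for N
      proof -
        note stop = stopping_index_met[OF N]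
        have "ereal (K * (\<phi> (\<alpha> N))\<^sup>2) = ereal K * ereal ((\<phi> (\<alpha> N))\<^sup>2)"
          by simp
        also have "\<dots> \<le> ereal K *
            (ereal \<tau> * (ext_inf \<phi> (ext_inf (Theta_inv \<phi>) (e N)))\<^sup>2)"
          using sq_le_ext_inf_Theta_inv[OF \<alpha> \<tau>1 e0 stop] K
          by (intro ereal_mult_left_mono) auto
        finally have D: "ereal (K * (\<phi> (\<alpha> N))\<^sup>2)
            \<le> ereal (K * \<tau>) * (ext_inf \<phi> (ext_inf (Theta_inv \<phi>) (e N)))\<^sup>2"
          by (simp add: mult.assoc[symmetric])
        have "ereal (K * Theta \<phi> (\<alpha> N)) = ereal K * ereal (Theta \<phi> (\<alpha> N))"
          by simp
        also have "\<dots> \<le> ereal K * (ereal \<tau> * e N)"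
          using stop K by (intro ereal_mult_left_mono) auto
        finally have "ereal (K * Theta \<phi> (\<alpha> N)) \<le> ereal (K * \<tau>) * e N"
          by (simp add: mult.assoc[symmetric])
        with D rate_K[of N] N show ?thesis
          by (auto intro: order_trans)
      qed
      ultimately show ?case
        by (simp add: Let_def e_def)
    qed
  qed
qed

end
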